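(* Let $d\in\mathbb{N}$ and $0<r\le R$. For each $n\in\mathbb{N}$, let $\mathcal{F}_n$ be a family of $(r,R)$-fat closed convex sets in $\mathbb{R}^d$. If $\{\mathcal{F}_n\}_{n\in\mathbb{N}}$ satisfies the weak heterochromatic $(\aleph_0,2)$-property, then there exist two indices $i\neq j$ such that each of $\mathcal{F}_i$ and $\mathcal{F}_j$ can be pierced by finitely many points (i.e. for each of them there is a finite set of points meeting every member of the family).
   Context: A set $A\subseteq\mathbb{R}^d$ is $(r,R)$-fat if it contains a closed ball of radius $r$ and is contained in a closed ball of radius $R$. A sequence $\{B_n\}_{n\in\mathbb{N}}$ is a strictly heterochromatic sequence of $\{\mathcal{F}_n\}$ if $B_n\in\mathcal{F}_n$ for every $n$. The collection $\{\mathcal{F}_n\}$ satisfies the weak heterochromatic $(\aleph_0,2)$-property if every strictly heterochromatic sequence $\{B_n\}$ contains two members $B_i,B_j$ with $i\ne j$ and $B_i\cap B_j\neq\emptyset$.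
   Formalization: Every family F_n is assumed nonempty; otherwise, with F_0 empty and every other F_n consisting of all closed balls of radius r, the weak heterochromatic property holds vacuously but only F_0 can be pierced by finitely many points. *)

theory Defs
  imports "HOL-Analysis.Analysis"
begin

definition fat :: "real \<Rightarrow> real \<Rightarrow> 'a::metric_space set \<Rightarrow> bool" where
  "fat r R A \<longleftrightarrow> (\<exists>x. cball x r \<subseteq> A) \<and> (\<exists>y. A \<subseteq> cball y R)"

definition strictly_heterochromatic :: "(nat \<Rightarrow> 'a set set) \<Rightarrow> (nat \<Rightarrow> 'a set) \<Rightarrow> bool" where
  "strictly_heterochromatic F B \<longleftrightarrow> (\<forall>n. B n \<in> F n)"

text \<open>
  The members of a sequence are distinguished by their indices, so two equal nonempty terms
  \<open>B i = B j\<close> with \<open>i \<noteq> j\<close> count as an intersecting pair. The property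
  holds vacuously if some \<open>F n\<close> is empty; results about it therefore assume that
  the families are nonempty.
\<close>

definition weak_heterochromatic_aleph0_2 :: "(nat \<Rightarrow> 'a set set) \<Rightarrow> bool" where
  "weak_heterochromatic_aleph0_2 F \<longleftrightarrow>
     (\<forall>B. strictly_heterochromatic F B \<longrightarrow> (\<exists>i j. i \<noteq> j \<and> B i \<inter> B j \<noteq> {}))"

definition finitely_pierceable :: "'a set set \<Rightarrow> bool" where
  "finitely_pierceable \<F> \<longleftrightarrow> (\<exists>P. finite P \<and> (\<forall>A\<in>\<F>. A \<inter> P \<noteq> {}))"

end

theory Submission
  imports Defs
begin

text \<open>
  A family of \<open>(r,R)\<close>-fat sets all meeting one bounded set \<open>K\<close> lives in a compact ball, so a
  finite \<open>r\<close>-net of that ball pierces it. Hence a family that is not finitely pierceable has, for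
  every bounded set, a member missing that set. If at most one family were finitely pierceable, one
  could fix a member of that family and choose the remaining members one after another, each
  disjoint from the fixed one and from those already chosen.
\<close>

lemma fat_imp_bounded: "bounded A" if "fat r R A"
  using that unfolding fat_def by (meson bounded_cball bounded_subset)

lemma finitely_pierceable_if_meet_bounded:
  fixes K :: "'a::heine_borel set"
  assumes "0 < r" "bounded K"
    and fat: "\<And>A. A \<in> \<F> \<Longrightarrow> fat r R A"
    and meet: "\<And>A. A \<in> \<F> \<Longrightarrow> A \<inter> K \<noteq> {}"
  shows "finitely_pierceable \<F>"
proof -
  obtain z a where K: "K \<subseteq> cball z a"
    using \<open>bounded K\<close> by (auto simp: bounded_def subset_iff mem_cball)
  \<comment> \<open>The net has to approximate the centres \<open>x\<close> of the inner balls. Such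
    an \<open>x\<close> and a point \<open>w\<close> of \<open>K\<close> both lie in a ball of
    radius \<open>R\<close>, so \<open>x\<close> is within \<open>2 * R\<close> of \<open>w\<close>,
    hence within \<open>a + 2 * R\<close> of \<open>z\<close>. A net point closer than
    \<open>r\<close> to \<open>x\<close> lies in \<open>cball x r\<close>, hence in the set.\<close>
  obtain P where "finite P" and P: "cball z (a + 2 * R) \<subseteq> (\<Union>p\<in>P. ball p r)"
    using compact_cball[of z "a + 2 * R"] \<open>0 < r\<close> unfolding compact_eq_totally_bounded by meson
  have "A \<inter> P \<noteq> {}" if "A \<in> \<F>" for A
  proof -
    obtain x y where x: "cball x r \<subseteq> A" and y: "A \<subseteq> cball y R"
      using fat[OF \<open>A \<in> \<F>\<close>] unfolding fat_def by blast
    obtain w where w: "w \<in> A" "w \<in> K"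
      using meet[OF \<open>A \<in> \<F>\<close>] by blast
    have "x \<in> A"
      using x \<open>0 < r\<close> by auto
    then have "dist y x \<le> R" "dist y w \<le> R" "dist z w \<le> a"
      using y w K by auto
    then have "x \<in> cball z (a + 2 * R)"
      using dist_triangle[of z x w] dist_triangle[of w x y] by (simp add: dist_commute)
    then obtain p where "p \<in> P" "dist p x < r"
      using P by auto
    then have "p \<in> A"
      using x by (auto simp: dist_commute)
    then show ?thesis
      using \<open>p \<in> P\<close> by blast
  qed
  then show ?thesis
    using \<open>finite P\<close> unfolding finitely_pierceable_def by blast
qed

theorem theorem15:
  fixes r R :: real
    and F :: "nat \<Rightarrow> (real ^ 'd) set set"
  assumes "0 < r" and "r \<le> R"
    and "\<And>n. F n \<noteq> {}"
    and "\<And>n A. A \<in> F n \<Longrightarrow> fat r R A \<and> closed A \<and> convex A"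
    and "weak_heterochromatic_aleph0_2 F"
  shows "\<exists>i j. i \<noteq> j \<and> finitely_pierceable (F i) \<and> finitely_pierceable (F j)"
proof (rule ccontr)
  assume "\<not> ?thesis"
  \<comment> \<open>\<open>k\<close> is the only index with a finitely pierceable family, or
    arbitrary if there is none.\<close>
  then obtain k where k: "\<And>n. n \<noteq> k \<Longrightarrow> \<not> finitely_pierceable (F n)"
    by metis
  obtain C where C: "C \<in> F k"
    using assms(3) by blast
  have fat: "fat r R A" if "A \<in> F n" for A n
    using assms(4) that by blast
  have avoid: "\<exists>A\<in>F n. A \<inter> K = {}" if "n \<noteq> k" "bounded K" for n K
    using finitely_pierceable_if_meet_bounded[OF \<open>0 < r\<close> \<open>bounded K\<close>, of "F n" R] fat k that
    by blast
  \<comment> \<open>\<open>f\<close> holds the choices before \<open>n\<close>. Every choice at an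
    index other than \<open>k\<close> avoids \<open>C\<close>, even before \<open>k\<close> is
    reached, since \<open>F k\<close> may offer no member avoiding a given bounded set.\<close>
  define Q where "Q f n A \<longleftrightarrow> A \<in> F n \<and>
    (if n = k then A = C else A \<inter> (C \<union> (\<Union>m<n. f m)) = {})" for f n A
  have "\<exists>B. \<forall>n. Q B n (B n)"
  proof (rule dependent_wellorder_choice)
    show "Q f n A = Q g n A" if "\<And>m. m < n \<Longrightarrow> f m = g m" for f g n A
      using that by (simp add: Q_def)
    show "\<exists>A. Q f n A" if "\<And>m. m < n \<Longrightarrow> Q f m (f m)" for f n
    proof (cases "n = k")
      case True
      then show ?thesis
        using C by (auto simp: Q_def)
    next
      case False
      \<comment> \<open>Only finitely many bounded sets precede \<open>n\<close>, so their union
        with \<open>C\<close> is a bounded set to avoid.\<close>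
      have "bounded (f m)" if "m < n" for m
        using \<open>\<And>m. m < n \<Longrightarrow> Q f m (f m)\<close>[OF that] fat fat_imp_bounded unfolding Q_def by blast
      then have "bounded (C \<union> (\<Union>m<n. f m))"
        using fat_imp_bounded[OF fat[OF C]] by auto
      from avoid[OF False this] show ?thesis
        using False by (auto simp: Q_def)
    qed
  qed
  then obtain B where B: "\<And>n. Q B n (B n)"
    by blast
  have "B m \<inter> B n = {}" if "m < n" for m n
  proof (cases "n = k")
    \<comment> \<open>Here \<open>B n\<close> is \<open>C\<close>, which the earlier choice
      \<open>B m\<close> already avoids.\<close>
    case True
    then show ?thesis
      using B[of n] B[of m] that by (auto simp: Q_def)
  next
    case False
    then show ?thesis
      using B[of n] that by (auto simp: Q_def)
  qed
  then have "B i \<inter> B j = {}" if "i \<noteq> j" for i j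
    using that by (metis Int_commute linorder_neqE_nat)
  moreover have "strictly_heterochromatic F B"
    using B by (simp add: strictly_heterochromatic_def Q_def)
  ultimately show False
    using assms(5) unfolding weak_heterochromatic_aleph0_2_def by blast
qed

end
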